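(* Let $r,s,r',s'\in[0,1]$ and write $\bar r'=1-r'$, $\bar s'=1-s'$. Let $H$ be the convex polygon (convex hull) with the six vertices $(0,0),(1,1),(r',s'),(s',r'),(\bar s',\bar r'),(\bar r',\bar s')$. (Infinite shared randomness) The BIBO channel with parameters $(r,s)$ can be simulated exactly from the BIBO channel with parameters $(r',s')$ with infinite shared randomness if and only if $(r,s)\in H$. (No shared randomness) The BIBO channel with parameters $(r,s)$ can be simulated exactly from the BIBO channel with parameters $(r',s')$ without shared randomness if $(r,s)$ lies in the union of the two (filled, possibly degenerate) parallelograms with vertices $(0,0),(r',s'),(\bar r',\bar s'),(1,1)$ and $(0,0),(s',r'),(\bar s',\bar r'),(1,1)$. Conversely, if the channel with parameters $(r,s)$ can be simulated exactly from the channel with parameters $(r',s')$ without shared randomness, then $(r,s)\in H$. In other words, the outer bound $H$ is the convex hull of the given achievable inner bound.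
   Context: A BIBO (binary-input binary-output) channel has input and output alphabets $\{0,1\}$. The BIBO channel with parameters $(r,s)$ is the one with $p_{Y|X}(0|0)=r$ and $p_{Y|X}(0|1)=s$. Exact simulation: $p(y|x)$ can be simulated exactly from $p(\tilde y|\tilde x)$ if for some $n$ there are a shared random variable $\omega$ (independent of the input $x^n$), a stochastic encoder $q^{\mathrm{enc}}(\tilde x^n|x^n,\omega)$ and a stochastic decoder $q^{\mathrm{dec}}(y^n|\tilde y^n,\omega)$ such that the induced channel $$q(y^n|x^n)=\sum_{\omega}p(\omega)\sum_{\tilde x^n,\tilde y^n}q^{\mathrm{enc}}(\tilde x^n|x^n,\omega)\Big(\prod_{i=1}^n p(\tilde y_i|\tilde x_i)\Big)q^{\mathrm{dec}}(y^n|\tilde y^n,\omega)$$ satisfies $q(y^n|x^n)=\prod_{i=1}^n p(y_i|x_i)$ for all $x^n,y^n$. No shared randomness means $\omega$ is constant (the encoder and decoder may still use independent private randomness, being stochastic maps). Infinite shared randomness means that $\omega$ may be any finite-valued random variable with arbitrary distribution. *)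

theory Defs
  imports "HOL-Probability.Probability"
begin

text \<open>A discrete memoryless channel is a stochastic map \<open>W :: 'x \<Rightarrow> 'y pmf\<close>, with
  \<open>p(y|x) = pmf (W x) y\<close>. Sequences \<open>x\<^sup>n\<close> are lists of length \<open>n\<close>.\<close>

definition words :: "nat \<Rightarrow> 'a list set" where
  "words n = {xs. length xs = n}"

definition memoryless :: "nat \<Rightarrow> ('x \<Rightarrow> 'y pmf) \<Rightarrow> 'x list \<Rightarrow> 'y list \<Rightarrow> real" where
  "memoryless n W xs ys = (\<Prod>i<n. pmf (W (xs ! i)) (ys ! i))"

text \<open>In the following, \<open>P\<close> is the distribution of the shared variable \<open>\<omega>\<close>. Its values are
  labelled by natural numbers, which is no restriction for a finite-valued variable. It is
  independent of the input because \<open>P\<close> does not depend on \<open>xs\<close>.\<close>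

definition induced_channel ::
  "nat \<Rightarrow> nat pmf \<Rightarrow> (nat \<Rightarrow> 'x list \<Rightarrow> 'u list pmf) \<Rightarrow> ('u \<Rightarrow> 'v pmf) \<Rightarrow>
   (nat \<Rightarrow> 'v list \<Rightarrow> 'y list pmf) \<Rightarrow> 'x list \<Rightarrow> 'y list \<Rightarrow> real" where
  "induced_channel n P enc W dec xs ys =
     (\<Sum>\<omega>\<in>set_pmf P. pmf P \<omega> *
        (\<Sum>us\<in>words n. \<Sum>vs\<in>words n.
           pmf (enc \<omega> xs) us * memoryless n W us vs * pmf (dec \<omega> vs) ys))"

definition block_map :: "nat \<Rightarrow> ('a list \<Rightarrow> 'b list pmf) \<Rightarrow> bool" where
  "block_map n K \<longleftrightarrow> (\<forall>xs\<in>words n. set_pmf (K xs) \<subseteq> words n)"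

definition exact_simulation ::
  "nat \<Rightarrow> nat pmf \<Rightarrow> (nat \<Rightarrow> 'x list \<Rightarrow> 'u list pmf) \<Rightarrow> (nat \<Rightarrow> 'v list \<Rightarrow> 'y list pmf) \<Rightarrow>
   ('x :: finite \<Rightarrow> 'y :: finite pmf) \<Rightarrow> ('u :: finite \<Rightarrow> 'v :: finite pmf) \<Rightarrow> bool" where
  "exact_simulation n P enc dec V W \<longleftrightarrow>
     (\<forall>\<omega>\<in>set_pmf P. block_map n (enc \<omega>) \<and> block_map n (dec \<omega>)) \<and>
     (\<forall>xs\<in>words n. \<forall>ys\<in>words n.
        induced_channel n P enc W dec xs ys = memoryless n V xs ys)"

text \<open>Below, \<open>V\<close> is simulated from \<open>W\<close>. The block length must be positive: for \<open>n = 0\<close> both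
  sides are identically 1 and every channel would simulate every other one.\<close>

definition simulable_shared ::
  "('x :: finite \<Rightarrow> 'y :: finite pmf) \<Rightarrow> ('u :: finite \<Rightarrow> 'v :: finite pmf) \<Rightarrow> bool" where
  "simulable_shared V W \<longleftrightarrow>
     (\<exists>n P enc dec. 0 < n \<and> finite (set_pmf P) \<and> exact_simulation n P enc dec V W)"

definition simulable_unshared ::
  "('x :: finite \<Rightarrow> 'y :: finite pmf) \<Rightarrow> ('u :: finite \<Rightarrow> 'v :: finite pmf) \<Rightarrow> bool" where
  "simulable_unshared V W \<longleftrightarrow>
     (\<exists>n \<omega> enc dec. 0 < n \<and> exact_simulation n (return_pmf \<omega>) enc dec V W)"

text \<open>The binary alphabet \<open>{0, 1}\<close> is \<^typ>\<open>bool\<close>, with \<^const>\<open>False\<close> for 0 and \<^const>\<open>True\<close>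
  for 1. As \<^const>\<open>bernoulli_pmf\<close> is parametrised by the probability of \<^const>\<open>True\<close>, the
  parameters \<open>r = p(0|0)\<close> and \<open>s = p(0|1)\<close> enter through their complements.\<close>

definition bibo :: "real \<Rightarrow> real \<Rightarrow> bool \<Rightarrow> bool pmf" where
  "bibo r s x = bernoulli_pmf (1 - (if x then s else r))"

lemma pmf_bibo:
  assumes "r \<in> {0..1}" "s \<in> {0..1}"
  shows "pmf (bibo r s False) False = r" "pmf (bibo r s False) True = 1 - r"
    and "pmf (bibo r s True) False = s" "pmf (bibo r s True) True = 1 - s"
  using assms by (auto simp: bibo_def)

definition hexagon :: "real \<Rightarrow> real \<Rightarrow> (real \<times> real) set" where
  "hexagon r s = convex hull {(0, 0), (1, 1), (r, s), (s, r), (1 - s, 1 - r), (1 - r, 1 - s)}"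

definition parallelogram :: "real \<Rightarrow> real \<Rightarrow> (real \<times> real) set" where
  "parallelogram r s = convex hull {(0, 0), (r, s), (1 - r, 1 - s), (1, 1)}"

end

theory Submission
  imports Defs
begin

text \<open>The converse rests on two quantities that do not increase under simulation with shared
  randomness and are multiplicative for memoryless channels: the largest likelihood ratio
  \<open>W(v|u) / W(v|u')\<close> and the sum \<open>\<Sum>v. max\<^sub>u W(v|u)\<close>. For a BIBO channel, put \<open>d = r - s\<close> and
  \<open>e = r + s - 1\<close>. The second quantity is \<open>1 + \<bar>d\<bar>\<close>, which gives \<open>\<bar>d\<bar> \<le> \<bar>d'\<bar>\<close>, and the first one
  gives \<open>(1 - \<bar>e'\<bar>) * \<bar>d\<bar> \<le> \<bar>d'\<bar> * (1 - \<bar>e\<bar>)\<close>; together these inequalities cut out the hexagon.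
  Conversely, block length one suffices: the parallelogram is what stochastic decoders achieve
  with a fixed bijective encoder, and one shared bit mixes the two bijective encoders.\<close>

section \<open>Sums over words\<close>

lemma finite_words [simp]: "finite (words n :: 'a::finite list set)"
  using finite_lists_length_eq[of "UNIV :: 'a set" n] by (simp add: words_def)

lemma words_0: "words 0 = {[]}"
  by (auto simp: words_def)

lemma words_Suc: "words (Suc n) = (\<lambda>(a, xs). a # xs) ` (UNIV \<times> words n)"
  by (auto simp: words_def length_Suc_conv image_iff)

text \<open>Distributivity, one letter at a time: sums over blocks become \<open>n\<close>-th powers
  of single-letter sums.\<close>

lemma sum_words_prod:
  fixes f :: "'a::finite \<Rightarrow> 'b::comm_semiring_1"
  shows "(\<Sum>xs\<in>words n. \<Prod>i<n. f (xs ! i)) = (\<Sum>a\<in>UNIV. f a) ^ n"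
proof (induction n)
  case 0
  then show ?case by (simp add: words_0)
next
  case (Suc n)
  have inj: "inj_on (\<lambda>(a, xs). a # xs) (UNIV \<times> words n)"
    by (auto simp: inj_on_def)
  have "(\<Sum>xs\<in>words (Suc n). \<Prod>i<Suc n. f (xs ! i))
      = (\<Sum>(a, xs)\<in>UNIV \<times> words n. f a * (\<Prod>i<n. f (xs ! i)))"
    unfolding words_Suc sum.reindex[OF inj]
    by (intro sum.cong) (auto simp: prod.lessThan_Suc_shift simp del: prod.lessThan_Suc)
  also have "\<dots> = (\<Sum>a\<in>UNIV. f a) * (\<Sum>xs\<in>words n. \<Prod>i<n. f (xs ! i))"
    by (simp add: sum_product sum.cartesian_product)
  finally show ?case
    by (simp add: Suc.IH)
qed

lemma sum_pmf_words:
  fixes K :: "'a list \<Rightarrow> 'b::finite list pmf"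
  assumes "block_map n K" "xs \<in> words n"
  shows "(\<Sum>us\<in>words n. pmf (K xs) us) = 1"
  using assms by (intro sum_pmf_eq_1) (auto simp: block_map_def)

section \<open>Two monotone quantities\<close>

text \<open>Every \<open>f i\<close> is below every \<open>g j\<close>, hence so are their averages.
  Two inputs induce different distributions of the encoded word, so the weights cannot be compared
  termwise.\<close>

lemma weighted_sum_le_weighted_sum:
  fixes p q f g :: "'a \<Rightarrow> real"
  assumes p: "\<And>i. i \<in> A \<Longrightarrow> 0 \<le> p i" "sum p A = 1"
    and q: "\<And>i. i \<in> A \<Longrightarrow> 0 \<le> q i" "sum q A = 1"
    and le: "\<And>i j. i \<in> A \<Longrightarrow> j \<in> A \<Longrightarrow> f i \<le> g j"
  shows "(\<Sum>i\<in>A. p i * f i) \<le> (\<Sum>j\<in>A. q j * g j)"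
proof -
  have *: "(\<Sum>i\<in>A. p i * f i) \<le> g j" if "j \<in> A" for j
  proof -
    have "(\<Sum>i\<in>A. p i * f i) \<le> (\<Sum>i\<in>A. p i * g j)"
      using that by (intro sum_mono mult_left_mono le p)
    then show ?thesis
      by (simp add: p flip: sum_distrib_right)
  qed
  have "(\<Sum>i\<in>A. p i * f i) = (\<Sum>j\<in>A. q j * (\<Sum>i\<in>A. p i * f i))"
    by (simp add: q flip: sum_distrib_right)
  also have "\<dots> \<le> (\<Sum>j\<in>A. q j * g j)"
    by (intro sum_mono mult_left_mono * q)
  finally show ?thesis .
qed

text \<open>The bound multiplies up to blocks and survives decoding, encoding and averaging over
  \<omega>, since \<omega> has the same law for both inputs. Avoiding quotients admits zero
  probabilities.\<close>

lemma simulable_shared_likelihood_ratio: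
  fixes V :: "'x::finite \<Rightarrow> 'y::finite pmf" and W :: "'u::finite \<Rightarrow> 'v::finite pmf"
  assumes sim: "simulable_shared V W"
    and nonneg: "0 \<le> a" "0 \<le> b"
    and ratio: "\<And>u u' v. a * pmf (W u) v \<le> b * pmf (W u') v"
  shows "a * pmf (V x) y \<le> b * pmf (V x') y"
proof -
  obtain n P enc dec where n: "0 < n"
    and enc: "\<And>\<omega>. \<omega> \<in> set_pmf P \<Longrightarrow> block_map n (enc \<omega>)"
    and V: "\<And>xs ys. xs \<in> words n \<Longrightarrow> ys \<in> words n \<Longrightarrow>
      induced_channel n P enc W dec xs ys = memoryless n V xs ys"
    using sim unfolding simulable_shared_def exact_simulation_def by blast
  have ratio_n: "a ^ n * memoryless n W us vs \<le> b ^ n * memoryless n W us' vs" for us us' vs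
  proof -
    have "(\<Prod>i<n. a * pmf (W (us ! i)) (vs ! i)) \<le> (\<Prod>i<n. b * pmf (W (us' ! i)) (vs ! i))"
      by (intro prod_mono conjI ratio) (simp add: nonneg)
    then show ?thesis
      by (simp add: memoryless_def prod.distrib)
  qed
  define R where "R \<omega> us ys = (\<Sum>vs\<in>words n. memoryless n W us vs * pmf (dec \<omega> vs) ys)"
    for \<omega> us ys
  have induced: "c * induced_channel n P enc W dec xs ys =
      (\<Sum>\<omega>\<in>set_pmf P. pmf P \<omega> * (\<Sum>us\<in>words n. pmf (enc \<omega> xs) us * (c * R \<omega> us ys)))"
    for c xs ys
    by (simp add: induced_channel_def R_def sum_distrib_left mult_ac)
  have R_le: "a ^ n * R \<omega> us ys \<le> b ^ n * R \<omega> us' ys" for \<omega> us us' ys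
    unfolding R_def sum_distrib_left
    by (intro sum_mono) (simp add: ratio_n mult_right_mono flip: mult.assoc)
  \<comment> \<open>On constant words the block inequality is the \<open>n\<close>-th power of the
    single-letter one.\<close>
  define xs xs' ys where "xs = replicate n x" "xs' = replicate n x'" "ys = replicate n y"
  have words: "xs \<in> words n" "xs' \<in> words n" "ys \<in> words n"
    by (auto simp: words_def xs_xs'_ys_def)
  have "a ^ n * induced_channel n P enc W dec xs ys \<le> b ^ n * induced_channel n P enc W dec xs' ys"
    unfolding induced
    by (intro sum_mono mult_left_mono weighted_sum_le_weighted_sum R_le)
      (simp_all add: sum_pmf_words enc words)
  then have "(a * pmf (V x) y) ^ n \<le> (b * pmf (V x') y) ^ n"
    by (simp add: V words) (simp add: memoryless_def xs_xs'_ys_def power_mult_distrib)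
  then show ?thesis
    using n nonneg by (subst (asm) power_mono_iff) auto
qed

text \<open>A maximizing \<open>h\<close> turns the left side into the sum of column maxima. A
  decoder only redistributes mass, so the total stays below that of the product bound
  \<open>M\<close>.\<close>

lemma simulable_shared_sum_max:
  fixes V :: "'x::finite \<Rightarrow> 'y::finite pmf" and W :: "'u::finite \<Rightarrow> 'v::finite pmf"
  assumes sim: "simulable_shared V W"
    and m: "\<And>u v. pmf (W u) v \<le> m v"
  shows "(\<Sum>y\<in>UNIV. pmf (V (h y)) y) \<le> (\<Sum>v\<in>UNIV. m v)"
proof -
  obtain n P enc dec where n: "0 < n" and fin: "finite (set_pmf P)"
    and enc: "\<And>\<omega>. \<omega> \<in> set_pmf P \<Longrightarrow> block_map n (enc \<omega>)"
    and dec: "\<And>\<omega>. \<omega> \<in> set_pmf P \<Longrightarrow> block_map n (dec \<omega>)"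
    and V: "\<And>xs ys. xs \<in> words n \<Longrightarrow> ys \<in> words n \<Longrightarrow>
      induced_channel n P enc W dec xs ys = memoryless n V xs ys"
    using sim unfolding simulable_shared_def exact_simulation_def by blast
  have m_nonneg: "0 \<le> m v" for v
    using m[of undefined v] pmf_nonneg[of "W undefined" v] by linarith
  define M where "M vs = (\<Prod>i<n. m (vs ! i))" for vs
  have M: "memoryless n W us vs \<le> M vs" for us vs
    unfolding memoryless_def M_def by (intro prod_mono) (simp add: m)
  have M_nonneg: "0 \<le> M vs" for vs
    by (simp add: M_def m_nonneg prod_nonneg)
  have map_words: "map h ys \<in> words n" if "ys \<in> words n" for ys
    using that by (simp add: words_def)
  \<comment> \<open>The input varies with \<open>ys\<close>, so the encoder must go before summing
    over \<open>ys\<close>: bounding the channel by \<open>M\<close> makes the rest independent of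
    \<open>us\<close>.\<close>
  have one: "(\<Sum>us\<in>words n. \<Sum>vs\<in>words n.
        pmf (enc \<omega> (map h ys)) us * memoryless n W us vs * pmf (dec \<omega> vs) ys)
      \<le> (\<Sum>vs\<in>words n. M vs * pmf (dec \<omega> vs) ys)" if "\<omega> \<in> set_pmf P" "ys \<in> words n" for \<omega> ys
  proof -
    have "(\<Sum>us\<in>words n. \<Sum>vs\<in>words n.
        pmf (enc \<omega> (map h ys)) us * memoryless n W us vs * pmf (dec \<omega> vs) ys)
      \<le> (\<Sum>us\<in>words n. \<Sum>vs\<in>words n. pmf (enc \<omega> (map h ys)) us * M vs * pmf (dec \<omega> vs) ys)"
      by (intro sum_mono mult_right_mono mult_left_mono M) simp_all
    also have "\<dots> = (\<Sum>us\<in>words n. pmf (enc \<omega> (map h ys)) us) *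
        (\<Sum>vs\<in>words n. M vs * pmf (dec \<omega> vs) ys)"
      by (simp add: sum_product mult.assoc)
    also have "\<dots> = (\<Sum>vs\<in>words n. M vs * pmf (dec \<omega> vs) ys)"
      using that by (simp add: sum_pmf_words enc map_words)
    finally show ?thesis .
  qed
  have "(\<Sum>y\<in>UNIV. pmf (V (h y)) y) ^ n = (\<Sum>ys\<in>words n. memoryless n V (map h ys) ys)"
    unfolding sum_words_prod[symmetric]
    by (intro sum.cong prod.cong refl) (auto simp: memoryless_def words_def)
  also have "\<dots> = (\<Sum>ys\<in>words n. induced_channel n P enc W dec (map h ys) ys)"
    by (simp add: V map_words)
  also have "\<dots> \<le> (\<Sum>ys\<in>words n. \<Sum>\<omega>\<in>set_pmf P. pmf P \<omega> *
      (\<Sum>vs\<in>words n. M vs * pmf (dec \<omega> vs) ys))"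
    unfolding induced_channel_def by (intro sum_mono mult_left_mono one) simp_all
  also have "\<dots> = (\<Sum>\<omega>\<in>set_pmf P. pmf P \<omega> *
      (\<Sum>ys\<in>words n. \<Sum>vs\<in>words n. M vs * pmf (dec \<omega> vs) ys))"
    by (subst sum.swap) (simp add: sum_distrib_left)
  also have "\<dots> = (\<Sum>\<omega>\<in>set_pmf P. pmf P \<omega> * (\<Sum>vs\<in>words n. M vs))"
  proof (intro sum.cong refl arg_cong2[where f = "(*)"])
    fix \<omega> assume "\<omega> \<in> set_pmf P"
    then have "(\<Sum>vs\<in>words n. M vs * (\<Sum>ys\<in>words n. pmf (dec \<omega> vs) ys)) = (\<Sum>vs\<in>words n. M vs)"
      by (intro sum.cong refl) (simp add: sum_pmf_words dec)
    then show "(\<Sum>ys\<in>words n. \<Sum>vs\<in>words n. M vs * pmf (dec \<omega> vs) ys) = (\<Sum>vs\<in>words n. M vs)"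
      by (subst sum.swap) (simp add: sum_distrib_left)
  qed
  also have "\<dots> = (\<Sum>vs\<in>words n. M vs)"
    using fin by (simp add: sum_pmf_eq_1 flip: sum_distrib_right)
  also have "\<dots> = (\<Sum>v\<in>UNIV. m v) ^ n"
    unfolding M_def by (rule sum_words_prod)
  finally show ?thesis
    using n by (subst (asm) power_mono_iff) (auto simp: sum_nonneg m_nonneg)
qed

section \<open>The hexagon\<close>

text \<open>The six vertices are the union of the two vertex sets, and replacing each set by its
  hull does not change the hull of the union.\<close>

lemma hexagon_eq_hull_parallelograms:
  "hexagon r s = convex hull (parallelogram r s \<union> parallelogram s r)"
proof -
  have "{(0, 0), (1, 1), (r, s), (s, r), (1 - s, 1 - r), (1 - r, 1 - s)} =
      {(0, 0), (r, s), (1 - r, 1 - s), (1, 1)} \<union> {(0, 0), (s, r), (1 - s, 1 - r), (1, 1)}"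
    by auto
  then show ?thesis
    unfolding hexagon_def parallelogram_def by (simp only: hull_Un_left[symmetric] hull_Un_right[symmetric])
qed

text \<open>\<alpha> and \<beta> will be the probabilities of decoding 0 from a received 0 and 1.
  The linear image of the unit square of such pairs is convex and contains the four
  vertices.\<close>

lemma parallelogram_decoder:
  assumes "(r, s) \<in> parallelogram r' s'"
  obtains \<alpha> \<beta> where "\<alpha> \<in> {0..1}" "\<beta> \<in> {0..1}"
    "r = r' * \<alpha> + (1 - r') * \<beta>" "s = s' * \<alpha> + (1 - s') * \<beta>"
proof -
  define F where "F = (\<lambda>(\<alpha>, \<beta>). (r' * \<alpha> + (1 - r') * \<beta>, s' * \<alpha> + (1 - s') * \<beta>))"
  have "linear F"
    by (rule linearI) (auto simp: F_def algebra_simps)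
  then have "convex (F ` ({0..1} \<times> {0..1}))"
    by (intro convex_linear_image convex_Times) simp_all
  moreover have "{(0, 0), (r', s'), (1 - r', 1 - s'), (1, 1)} = F ` ({0, 1} \<times> {0, 1})"
    by (auto simp: F_def)
  then have "{(0, 0), (r', s'), (1 - r', 1 - s'), (1, 1)} \<subseteq> F ` ({0..1} \<times> {0..1})"
    by auto
  ultimately have "parallelogram r' s' \<subseteq> F ` ({0..1} \<times> {0..1})"
    unfolding parallelogram_def by (rule hull_minimal[rotated])
  then show thesis
    using assms that by (auto simp: F_def)
qed

text \<open>In the coordinates \<open>d\<close> and \<open>e\<close> the vertices are (0, 1), (0,
  -1) and the points (c, f) with all choices of signs. The hypotheses bound \<bar>d\<bar> by
  \<open>c\<close>, and \<bar>e\<bar> by the height of the edge from (0, 1) to (c, f).\<close>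

lemma in_hexagonI:
  assumes rs: "r \<in> {0..1}" "s \<in> {0..1}"
    and diff: "\<bar>r - s\<bar> \<le> \<bar>r' - s'\<bar>"
    and slope: "(1 - \<bar>r' + s' - 1\<bar>) * \<bar>r - s\<bar> \<le> \<bar>r' - s'\<bar> * (1 - \<bar>r + s - 1\<bar>)"
  shows "(r, s) \<in> hexagon r' s'"
proof -
  define pt :: "real \<Rightarrow> real \<Rightarrow> real \<times> real"
    where "pt d e = ((1 + e + d) / 2, (1 + e - d) / 2)" for d e
  define d e c f where "d = r - s" "e = r + s - 1" "c = \<bar>r' - s'\<bar>" "f = \<bar>r' + s' - 1\<bar>"
  note defs = d_e_c_f_def
  have conv: "convex (hexagon r' s')"
    by (simp add: hexagon_def)
  have mix: "pt ((1 - t) * d1 + t * d2) ((1 - t) * e1 + t * e2) \<in> hexagon r' s'"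
    if "pt d1 e1 \<in> hexagon r' s'" "pt d2 e2 \<in> hexagon r' s'" "0 \<le> t" "t \<le> 1" for t d1 d2 e1 e2
  proof -
    have "(1 - t) *\<^sub>R pt d1 e1 + t *\<^sub>R pt d2 e2 \<in> hexagon r' s'"
      using that by (intro convexD[OF conv]) auto
    moreover have "(1 - t) *\<^sub>R pt d1 e1 + t *\<^sub>R pt d2 e2 =
        pt ((1 - t) * d1 + t * d2) ((1 - t) * e1 + t * e2)"
      by (simp add: pt_def field_simps)
    ultimately show ?thesis
      by simp
  qed
  have vertices: "{(0, 0), (1, 1), (r', s'), (s', r'), (1 - s', 1 - r'), (1 - r', 1 - s')}
      \<subseteq> hexagon r' s'"
    unfolding hexagon_def by (rule hull_subset)
  have apex: "pt 0 1 \<in> hexagon r' s'" "pt 0 (-1) \<in> hexagon r' s'"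
    using vertices by (auto simp: pt_def)
  have corner: "pt c' f' \<in> hexagon r' s'" if "\<bar>c'\<bar> = c" "\<bar>f'\<bar> = f" for c' f'
  proof -
    have "c' = r' - s' \<or> c' = s' - r'" "f' = r' + s' - 1 \<or> f' = 1 - r' - s'"
      using that by (auto simp: defs abs_if split: if_splits)
    then have "pt c' f' \<in> {(r', s'), (s', r'), (1 - s', 1 - r'), (1 - r', 1 - s')}"
      by (auto simp: pt_def field_simps)
    then show ?thesis
      using vertices by auto
  qed
  \<comment> \<open>The weight \<open>(1 + \<theta>) / 2\<close> reaches height
    \<open>\<theta> * e0\<close> on the vertical segment from \<open>- e0\<close> to
    \<open>e0\<close>.\<close>
  have scale: "pt d0 (\<theta> * e0) \<in> hexagon r' s'"
    if "pt d0 e0 \<in> hexagon r' s'" "pt d0 (- e0) \<in> hexagon r' s'" "\<bar>\<theta>\<bar> \<le> 1" for d0 e0 \<theta>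
  proof -
    have "pt ((1 - (1 + \<theta>) / 2) * d0 + (1 + \<theta>) / 2 * d0)
        ((1 - (1 + \<theta>) / 2) * (- e0) + (1 + \<theta>) / 2 * e0) \<in> hexagon r' s'"
      using that by (intro mix) auto
    then show ?thesis
      by (simp add: algebra_simps add_divide_distrib diff_divide_distrib)
  qed
  have e: "\<bar>e\<bar> \<le> 1"
    using rs by (auto simp: defs)
  have rs_pt: "(r, s) = pt d e"
    by (simp add: pt_def defs)
  show ?thesis
  proof (cases "c = 0")
    case True
    then have "d = 0"
      using diff by (simp add: defs)
    then show ?thesis
      using scale[of 0 1 e] apex e by (simp add: rs_pt)
  next
    case False
    then have c: "0 < c"
      by (simp add: defs)
    define \<mu> where "\<mu> = \<bar>d\<bar> / c"
    have \<mu>: "0 \<le> \<mu>" "\<mu> \<le> 1" "\<bar>d\<bar> = \<mu> * c"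
      using c diff by (simp_all add: \<mu>_def defs)
    \<comment> \<open>Half the height of the vertical section at \<bar>d\<bar> = \<mu> * c.\<close>
    define m where "m = (1 - \<mu>) + \<mu> * f"
    have f: "0 \<le> f"
      by (simp add: defs)
    have "c * ((1 - f) * \<mu>) \<le> c * (1 - \<bar>e\<bar>)"
      using slope \<mu>(3) by (simp add: defs mult_ac)
    then have em: "\<bar>e\<bar> \<le> m"
      unfolding mult_le_cancel_left_pos[OF c] by (simp add: m_def algebra_simps)
    \<comment> \<open>If \<open>m = 0\<close>, then \<open>em\<close> forces \<open>e = 0\<close>,
      and division by zero gives \<theta> = 0, as required.\<close>
    define \<theta> where "\<theta> = e / m"
    have \<theta>: "\<bar>\<theta>\<bar> \<le> 1" "e = \<theta> * m"
      using em by (auto simp: \<theta>_def divide_le_eq_1)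
    define c' where "c' = (if d < 0 then - c else c)"
    have c': "\<bar>c'\<bar> = c" "d = \<mu> * c'"
      using \<mu>(3) c by (auto simp: c'_def abs_if split: if_splits)
    \<comment> \<open>Apex and corner are lowered by the same factor \<theta>, so mixing them with
      weight \<mu> gives height \<theta> * m = e.\<close>
    have "pt ((1 - \<mu>) * 0 + \<mu> * c') ((1 - \<mu>) * (\<theta> * 1) + \<mu> * (\<theta> * f)) \<in> hexagon r' s'"
      using \<mu> \<theta> c' f by (intro mix scale apex corner) auto
    moreover have "(1 - \<mu>) * (\<theta> * 1) + \<mu> * (\<theta> * f) = e"
      by (simp add: \<theta>(2) m_def algebra_simps)
    ultimately show ?thesis
      by (simp add: rs_pt c'(2))
  qed
qed

section \<open>BIBO channels\<close>

lemma simulable_shared_bibo_imp_hexagon: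
  assumes rs: "r \<in> {0..1}" "s \<in> {0..1}" "r' \<in> {0..1}" "s' \<in> {0..1}"
    and sim: "simulable_shared (bibo r s) (bibo r' s')"
  shows "(r, s) \<in> hexagon r' s'"
proof (rule in_hexagonI[OF rs(1,2)])
  note pmfs = pmf_bibo[OF rs(1,2)] pmf_bibo[OF rs(3,4)]
  define m where "m v = max (pmf (bibo r' s' False) v) (pmf (bibo r' s' True) v)" for v
  have "(\<Sum>y\<in>UNIV. pmf (bibo r s (h y)) y) \<le> (\<Sum>v\<in>UNIV. m v)" for h
    by (rule simulable_shared_sum_max[OF sim]) (metis (full_types) m_def max.cobounded1 max.cobounded2)
  \<comment> \<open>These are the two non-constant choices of \<open>h\<close>; a constant one only
    gives the sum 1.\<close>
  from this[of "\<lambda>y. y"] this[of Not]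
  have "r + (1 - s) \<le> max r' s' + max (1 - r') (1 - s')"
    "s + (1 - r) \<le> max r' s' + max (1 - r') (1 - s')"
    by (auto simp: UNIV_bool pmfs m_def)
  then show "\<bar>r - s\<bar> \<le> \<bar>r' - s'\<bar>"
    by linarith

  text \<open>For \<open>r' \<noteq> s'\<close>, \<open>b / a\<close> is the largest likelihood ratio of the channel with parameters
    \<open>(r', s')\<close>; stating it without the quotient covers the case \<open>a = 0\<close>.\<close>
  define a b where "a = 1 - \<bar>r' + s' - 1\<bar> - \<bar>r' - s'\<bar>" and "b = 1 - \<bar>r' + s' - 1\<bar> + \<bar>r' - s'\<bar>"
  have nonneg: "0 \<le> a" "0 \<le> b"
    using rs by (auto simp: a_def b_def)
  have ratio: "a * pmf (bibo r' s' u) v \<le> b * pmf (bibo r' s' u') v" for u u' v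
  proof -
    have ab: "a \<le> b" by (simp add: a_def b_def)
    \<comment> \<open>Here \<open>p\<close> and \<open>q\<close> are entries of one column: equal if
      the inputs agree, otherwise with sum \<open>r' + s'\<close> or
      \<open>2 - r' - s'\<close>.\<close>
    have *: "a * p \<le> b * q"
      if "0 \<le> p" "0 \<le> q"
        "p \<le> q \<or> p - q \<le> \<bar>r' - s'\<bar> \<and> \<bar>p + q - 1\<bar> = \<bar>r' + s' - 1\<bar>" for p q
    proof (cases "p \<le> q")
      case True
      then show ?thesis
        using ab nonneg that by (intro mult_mono) auto
    next
      case False
      with that have "p - q \<le> \<bar>r' - s'\<bar>" "1 - \<bar>r' + s' - 1\<bar> \<le> p + q"
        by auto
      then have "(p - q) * (1 - \<bar>r' + s' - 1\<bar>) \<le> \<bar>r' - s'\<bar> * (p + q)"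
        using rs by (intro mult_mono) auto
      then show ?thesis
        by (simp add: a_def b_def algebra_simps)
    qed
    show ?thesis
      by (rule *; cases u; cases u'; cases v) (use rs in \<open>auto simp: pmfs\<close>)
  qed
  have "a * pmf (bibo r s x) y \<le> b * pmf (bibo r s x') y" for x x' y
    by (rule simulable_shared_likelihood_ratio[OF sim nonneg ratio])
  \<comment> \<open>Both outputs and both orders of the inputs: in terms of d = r - s and e = r + s
    - 1, the instances bound \<open>(a + b) * d\<close> and \<open>- (a + b) * d\<close> by
    \<open>(b - a) * (1 + e)\<close> and \<open>(b - a) * (1 - e)\<close>.\<close>
  from this[of False False True] this[of True False False]
    this[of False True True] this[of True True False]
  have "(a + b) * \<bar>r - s\<bar> \<le> (b - a) * (1 - \<bar>r + s - 1\<bar>)"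
    by (auto simp: pmfs abs_if algebra_simps)
  then show "(1 - \<bar>r' + s' - 1\<bar>) * \<bar>r - s\<bar> \<le> \<bar>r' - s'\<bar> * (1 - \<bar>r + s - 1\<bar>)"
    by (simp add: a_def b_def algebra_simps)
qed

section \<open>Achievability with block length one\<close>

lemma sum_words_1:
  fixes g :: "'a::finite list \<Rightarrow> 'b::comm_monoid_add"
  shows "(\<Sum>us\<in>words (Suc 0). g us) = (\<Sum>u\<in>UNIV. g [u])"
proof -
  have "words (Suc 0) = range (\<lambda>u::'a. [u])"
    by (auto simp: words_def length_Suc_conv)
  then show ?thesis
    by (simp add: sum.reindex inj_on_def)
qed

text \<open>The encoder is deterministic, so its sum collapses to one term; all private randomness
  sits in the decoder \<open>K \<omega>\<close>.\<close>

lemma exact_simulation_single_letter: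
  fixes V :: "'x::finite \<Rightarrow> 'y::finite pmf" and W :: "'u::finite \<Rightarrow> 'v::finite pmf"
  assumes V: "\<And>x y. pmf (V x) y =
    (\<Sum>\<omega>\<in>set_pmf P. pmf P \<omega> * (\<Sum>v\<in>UNIV. pmf (W (f \<omega> x)) v * pmf (K \<omega> v) y))"
  shows "exact_simulation 1 P (\<lambda>\<omega> xs. return_pmf (map (f \<omega>) xs))
    (\<lambda>\<omega> vs. map_pmf (\<lambda>y. [y]) (K \<omega> (hd vs))) V W"
proof -
  have single: "\<exists>x. xs = [x]" if "xs \<in> words (Suc 0)" for xs :: "'a list"
    using that by (auto simp: words_def length_Suc_conv)
  have "pmf (map_pmf (\<lambda>y. [y]) q) [y] = pmf q y" for q :: "'y pmf" and y
    by (rule pmf_map_inj') (simp add: inj_def)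
  moreover have "(\<Sum>u\<in>UNIV. \<Sum>v\<in>UNIV. pmf (return_pmf [a]) [u] * g u v) = (\<Sum>v\<in>UNIV. g a v)"
    for a :: 'u and g :: "'u \<Rightarrow> 'v \<Rightarrow> real"
  proof -
    have "(\<Sum>u\<in>UNIV. \<Sum>v\<in>UNIV. pmf (return_pmf [a]) [u] * g u v) =
        (\<Sum>u\<in>UNIV. if u = a then \<Sum>v\<in>UNIV. g u v else 0)"
      by (intro sum.cong refl) (auto simp: indicator_def)
    then show ?thesis
      by simp
  qed
  ultimately have "induced_channel (Suc 0) P (\<lambda>\<omega> xs. return_pmf (map (f \<omega>) xs)) W
      (\<lambda>\<omega> vs. map_pmf (\<lambda>y. [y]) (K \<omega> (hd vs))) [x] [y] = memoryless (Suc 0) V [x] [y]" for x y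
    unfolding induced_channel_def sum_words_1
    by (simp add: memoryless_def V mult.assoc del: pmf_return)
  then show ?thesis
    by (auto simp: exact_simulation_def block_map_def dest!: single) (auto simp: words_def)
qed

text \<open>The entries are affine in the parameters on the unit interval, outside which
  \<open>bernoulli_pmf\<close> truncates.\<close>

lemma pmf_bibo_convex:
  assumes "r1 \<in> {0..1}" "s1 \<in> {0..1}" "r2 \<in> {0..1}" "s2 \<in> {0..1}" "t \<in> {0..1}"
  shows "pmf (bibo (t * r1 + (1 - t) * r2) (t * s1 + (1 - t) * s2) x) y =
    t * pmf (bibo r1 s1 x) y + (1 - t) * pmf (bibo r2 s2 x) y"
proof -
  have "t * p + (1 - t) * q \<in> {0..1}" if "p \<in> {0..1}" "q \<in> {0..1}" for p q :: real
    using that assms(5) convexD_alt[of "{0..1}" q p t] by (simp add: algebra_simps)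
  note * = this[OF assms(1,3)] this[OF assms(2,4)]
  show ?thesis
    by (cases x; cases y)
      (simp_all only: pmf_bibo[OF *] pmf_bibo[OF assms(1,2)] pmf_bibo[OF assms(3,4)],
       simp_all add: algebra_simps)
qed

text \<open>The decoder is itself a BIBO channel, with parameters \<alpha> and \<beta>.\<close>

lemma parallelogram_bibo:
  assumes rs': "r' \<in> {0..1}" "s' \<in> {0..1}" and rs: "(r, s) \<in> parallelogram r' s'"
  obtains K where "r \<in> {0..1}" "s \<in> {0..1}"
    "\<And>x y. pmf (bibo r s x) y = (\<Sum>v\<in>UNIV. pmf (bibo r' s' x) v * pmf (K v) y)"
proof -
  obtain \<alpha> \<beta> where ab: "\<alpha> \<in> {0..1}" "\<beta> \<in> {0..1}"
    and r: "r = r' * \<alpha> + (1 - r') * \<beta>" and s: "s = s' * \<alpha> + (1 - s') * \<beta>"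
    using parallelogram_decoder[OF rs] by blast
  have "p * \<alpha> + (1 - p) * \<beta> \<in> {0..1}" if "p \<in> {0..1}" for p
    using that ab convexD_alt[of "{0..1}" \<beta> \<alpha> p] by (simp add: algebra_simps)
  then have rs01: "r \<in> {0..1}" "s \<in> {0..1}"
    using rs' unfolding r s by blast+
  have "pmf (bibo r s x) y = (\<Sum>v\<in>UNIV. pmf (bibo r' s' x) v * pmf (bibo \<alpha> \<beta> v) y)" for x y
    by (cases x; cases y)
      (simp_all add: pmf_bibo[OF rs01] pmf_bibo[OF rs'] pmf_bibo[OF ab] UNIV_bool,
       simp_all add: r s algebra_simps)
  then show thesis
    using that rs01 by blast
qed

text \<open>An encoder that inverts the input thus reaches the second parallelogram.\<close>

lemma bibo_swap: "bibo s r x = bibo r s (\<not> x)"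
  by (simp add: bibo_def)

lemma simulable_unshared_parallelogram:
  assumes "r' \<in> {0..1}" "s' \<in> {0..1}"
    and "(r, s) \<in> parallelogram r' s' \<union> parallelogram s' r'"
  shows "simulable_unshared (bibo r s) (bibo r' s')"
proof -
  obtain f K where "\<And>x y. pmf (bibo r s x) y = (\<Sum>v\<in>UNIV. pmf (bibo r' s' (f x)) v * pmf (K v) y)"
  proof (cases "(r, s) \<in> parallelogram r' s'")
    case True
    then show thesis
      using that[of "\<lambda>x. x"] parallelogram_bibo[OF assms(1,2)] by metis
  next
    case False
    then have "(r, s) \<in> parallelogram s' r'"
      using assms by blast
    then show thesis
      using that[of Not] parallelogram_bibo[OF assms(2,1)] bibo_swap by metis
  qed
  then have "exact_simulation 1 (return_pmf 0) (\<lambda>_ xs. return_pmf (map f xs))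
      (\<lambda>_ vs. map_pmf (\<lambda>y. [y]) (K (hd vs))) (bibo r s) (bibo r' s')"
    by (intro exact_simulation_single_letter[where f = "\<lambda>_. f" and K = "\<lambda>_. K"]) simp
  then show ?thesis
    unfolding simulable_unshared_def by (intro exI conjI) auto
qed

text \<open>Each point of the hull of two nonempty convex sets lies on a segment joining them. Its
  weight \<open>t\<close> becomes the probability that the shared bit selects the first
  parallelogram's scheme.\<close>

lemma simulable_shared_hexagon:
  assumes rs': "r' \<in> {0..1}" "s' \<in> {0..1}" and hex: "(r, s) \<in> hexagon r' s'"
  shows "simulable_shared (bibo r s) (bibo r' s')"
proof -
  have "parallelogram a b \<noteq> {} \<and> convex (parallelogram a b)" for a b
    by (simp add: parallelogram_def)
  then obtain t u r1 s1 r2 s2 where t: "0 \<le> t" "0 \<le> u" "t + u = 1"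
    and p1: "(r1, s1) \<in> parallelogram r' s'" and p2: "(r2, s2) \<in> parallelogram s' r'"
    and rs_eq: "(r, s) = t *\<^sub>R (r1, s1) + u *\<^sub>R (r2, s2)"
    using hex unfolding hexagon_eq_hull_parallelograms
    by (subst (asm) convex_hull_union_two) auto
  obtain K1 where K1: "r1 \<in> {0..1}" "s1 \<in> {0..1}"
    "\<And>x y. pmf (bibo r1 s1 x) y = (\<Sum>v\<in>UNIV. pmf (bibo r' s' x) v * pmf (K1 v) y)"
    using parallelogram_bibo[OF rs' p1] by blast
  obtain K2 where K2: "r2 \<in> {0..1}" "s2 \<in> {0..1}"
    "\<And>x y. pmf (bibo r2 s2 x) y = (\<Sum>v\<in>UNIV. pmf (bibo s' r' x) v * pmf (K2 v) y)"
    using parallelogram_bibo[OF rs'(2,1) p2] by blast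
  define P :: "nat pmf" where "P = map_pmf of_bool (bernoulli_pmf t)"
  define f :: "nat \<Rightarrow> bool \<Rightarrow> bool" where "f \<omega> x = (if \<omega> = 1 then x else \<not> x)" for \<omega> x
  define K where "K \<omega> = (if \<omega> = 1 then K1 else K2)" for \<omega> :: nat
  have t01: "t \<in> {0..1}" and u: "u = 1 - t"
    using t by auto
  have P: "pmf P 1 = t" "pmf P 0 = u"
    using t01 pmf_map_inj'[of "of_bool :: bool \<Rightarrow> nat" "bernoulli_pmf t" True]
      pmf_map_inj'[of "of_bool :: bool \<Rightarrow> nat" "bernoulli_pmf t" False]
    by (simp_all add: P_def u inj_def)
  have set_P: "set_pmf P \<subseteq> {0, 1}"
    by (auto simp: P_def)
  have "pmf (bibo r s x) y =
    (\<Sum>\<omega>\<in>set_pmf P. pmf P \<omega> * (\<Sum>v\<in>UNIV. pmf (bibo r' s' (f \<omega> x)) v * pmf (K \<omega> v) y))" for x y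
  proof -
    have "pmf (bibo r s x) y = t * pmf (bibo r1 s1 x) y + u * pmf (bibo r2 s2 x) y"
      using rs_eq pmf_bibo_convex[OF K1(1,2) K2(1,2) t01] by (simp add: u)
    also have "\<dots> = (\<Sum>\<omega>\<in>{0, 1}. pmf P \<omega> *
        (\<Sum>v\<in>UNIV. pmf (bibo r' s' (f \<omega> x)) v * pmf (K \<omega> v) y))"
      using P by (simp add: K1(3) K2(3) f_def K_def bibo_swap[of s' r'])
    \<comment> \<open>For \<open>t\<close> equal to 0 or 1 the support is a single point, and the
      extra term has weight 0.\<close>
    also have "\<dots> = (\<Sum>\<omega>\<in>set_pmf P. pmf P \<omega> *
        (\<Sum>v\<in>UNIV. pmf (bibo r' s' (f \<omega> x)) v * pmf (K \<omega> v) y))"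
      using set_P by (intro sum.mono_neutral_right) (auto simp: set_pmf_iff)
    finally show ?thesis .
  qed
  note exact_simulation_single_letter[OF this]
  moreover have "finite (set_pmf P)"
    using set_P finite_subset by blast
  ultimately show ?thesis
    unfolding simulable_shared_def by (intro exI conjI) auto
qed

lemma simulable_unshared_imp_shared:
  "simulable_unshared V W \<Longrightarrow> simulable_shared V W"
  unfolding simulable_unshared_def simulable_shared_def
  by (metis finite.emptyI finite.insertI set_return_pmf)

theorem theorem12:
  fixes r s r' s' :: real
  assumes "r \<in> {0..1}" "s \<in> {0..1}" "r' \<in> {0..1}" "s' \<in> {0..1}"
  shows "(simulable_shared (bibo r s) (bibo r' s') \<longleftrightarrow> (r, s) \<in> hexagon r' s') \<and>
    ((r, s) \<in> parallelogram r' s' \<union> parallelogram s' r' \<longrightarrow>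
       simulable_unshared (bibo r s) (bibo r' s')) \<and>
    (simulable_unshared (bibo r s) (bibo r' s') \<longrightarrow> (r, s) \<in> hexagon r' s') \<and>
    hexagon r' s' = convex hull (parallelogram r' s' \<union> parallelogram s' r')"
  using simulable_shared_bibo_imp_hexagon[OF assms] simulable_shared_hexagon[OF assms(3,4)]
    simulable_unshared_parallelogram[OF assms(3,4)] simulable_shared_bibo_imp_hexagon[OF assms simulable_unshared_imp_shared]
    hexagon_eq_hull_parallelograms[of r' s']
  by (intro conjI iffI impI)

end
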